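(* Let $G=(V,E)$ be a finite connected simple graph with minimum vertex degree $\delta(G)$ and edge-connectivity $\kappa'(G)$. If $G$ has non-negative Lin-Lu-Yau curvature, then $\kappa'(G)=\delta(G)$.
   Context: All graphs are simple (no loops or multiple edges) and locally finite. The edge-connectivity $\kappa'(G)$ of a graph with at least two vertices is the minimum cardinality of an edge cut, where an edge cut is a set of edges whose deletion increases the number of connected components; the edge-connectivity of a single vertex is $0$. Let $d(x,y)$ be the combinatorial graph distance and $d_x$ the degree of $x$. For probability measures $\mu_1,\mu_2$ on $V$, the Wasserstein distance is $W(\mu_1,\mu_2)=\inf_\pi\sum_{x,y\in V}d(x,y)\pi(x,y)$, the infimum over all $\pi:V\times V\to[0,1]$ with $\sum_y\pi(x,y)=\mu_1(x)$ and $\sum_x\pi(x,y)=\mu_2(y)$ for all $x,y$. For $x\in V$ and $\rho\in[0,1]$ let $\mu_x^\rho(x)=\rho$, $\mu_x^\rho(v)=\frac{1-\rho}{d_x}$ if $v\sim x$, and $\mu_x^\rho(v)=0$ otherwise. For distinct $x,y$, $\kappa_\rho(x,y)=1-\frac{W(\mu_x^\rho,\mu_y^\rho)}{d(x,y)}$, and the Lin-Lu-Yau curvature is $\kappa_{LLY}(x,y)=\lim_{\rho\to1}\frac{\kappa_\rho(x,y)}{1-\rho}$. $G$ has non-negative Lin-Lu-Yau curvature if $\kappa_{LLY}(x,y)\ge0$ for all pairs of distinct vertices $x,y$ (equivalently, for all edges $x\sim y$). *)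

theory Defs
  imports Complex_Main
begin

text \<open>
  A graph is given by its vertex set \<open>V\<close> and its set \<open>E\<close> of two-element edges.
  The sums over \<open>V\<close> and the minima below are meaningful for finite \<open>V\<close> only.
\<close>

definition simple_graph :: "'a set \<Rightarrow> 'a set set \<Rightarrow> bool" where
  "simple_graph V E \<longleftrightarrow> (\<forall>e\<in>E. e \<subseteq> V \<and> card e = 2)"

definition adj :: "'a set set \<Rightarrow> 'a \<Rightarrow> 'a \<Rightarrow> bool" where
  "adj E x y \<longleftrightarrow> {x, y} \<in> E"

definition degree :: "'a set set \<Rightarrow> 'a \<Rightarrow> nat" where
  "degree E x = card {y. adj E x y}"

definition min_degree :: "'a set \<Rightarrow> 'a set set \<Rightarrow> nat" where
  "min_degree V E = Min (degree E ` V)"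

definition connected_graph :: "'a set \<Rightarrow> 'a set set \<Rightarrow> bool" where
  "connected_graph V E \<longleftrightarrow> V \<noteq> {} \<and> (\<forall>x\<in>V. \<forall>y\<in>V. (adj E)\<^sup>*\<^sup>* x y)"

definition graph_components :: "'a set \<Rightarrow> 'a set set \<Rightarrow> 'a set set" where
  "graph_components V E = V // {(x, y). x \<in> V \<and> y \<in> V \<and> (adj E)\<^sup>*\<^sup>* x y}"

definition edge_cut :: "'a set \<Rightarrow> 'a set set \<Rightarrow> 'a set set \<Rightarrow> bool" where
  "edge_cut V E F \<longleftrightarrow>
     F \<subseteq> E \<and> card (graph_components V E) < card (graph_components V (E - F))"

definition edge_connectivity :: "'a set \<Rightarrow> 'a set set \<Rightarrow> nat" where
  "edge_connectivity V E = (if card V = 1 then 0 else Min {card F | F. edge_cut V E F})"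

text \<open>The number of edges of a shortest walk; unspecified if there is no walk.\<close>

definition graph_dist :: "'a set set \<Rightarrow> 'a \<Rightarrow> 'a \<Rightarrow> nat" where
  "graph_dist E x y = (LEAST n. (adj E ^^ n) x y)"

text \<open>Measures on \<open>V\<close> are represented by their point masses.\<close>

definition couplings :: "'a set \<Rightarrow> ('a \<Rightarrow> real) \<Rightarrow> ('a \<Rightarrow> real) \<Rightarrow> ('a \<Rightarrow> 'a \<Rightarrow> real) set" where
  "couplings V \<mu>1 \<mu>2 = {\<pi>.
     (\<forall>x\<in>V. \<forall>y\<in>V. 0 \<le> \<pi> x y \<and> \<pi> x y \<le> 1) \<and>
     (\<forall>x\<in>V. (\<Sum>y\<in>V. \<pi> x y) = \<mu>1 x) \<and>
     (\<forall>y\<in>V. (\<Sum>x\<in>V. \<pi> x y) = \<mu>2 y)}"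

definition wasserstein :: "'a set \<Rightarrow> 'a set set \<Rightarrow> ('a \<Rightarrow> real) \<Rightarrow> ('a \<Rightarrow> real) \<Rightarrow> real" where
  "wasserstein V E \<mu>1 \<mu>2 =
     (INF \<pi>\<in>couplings V \<mu>1 \<mu>2. \<Sum>x\<in>V. \<Sum>y\<in>V. real (graph_dist E x y) * \<pi> x y)"

definition lazy_measure :: "'a set set \<Rightarrow> real \<Rightarrow> 'a \<Rightarrow> 'a \<Rightarrow> real" where
  "lazy_measure E \<rho> x v =
     (if v = x then \<rho> else if adj E x v then (1 - \<rho>) / real (degree E x) else 0)"

definition lazy_curvature :: "'a set \<Rightarrow> 'a set set \<Rightarrow> real \<Rightarrow> 'a \<Rightarrow> 'a \<Rightarrow> real" where
  "lazy_curvature V E \<rho> x y =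
     1 - wasserstein V E (lazy_measure E \<rho> x) (lazy_measure E \<rho> y) / real (graph_dist E x y)"

text \<open>
  The limit is one-sided because \<open>\<rho>\<close> ranges over the unit interval. It exists for distinct
  vertices of a finite connected graph: \<open>lazy_curvature\<close> is concave in \<open>\<rho>\<close> and vanishes at
  \<open>\<rho> = 1\<close>, so the quotient is monotone, and it is bounded.
\<close>

definition LLY_curvature :: "'a set \<Rightarrow> 'a set set \<Rightarrow> 'a \<Rightarrow> 'a \<Rightarrow> real" where
  "LLY_curvature V E x y = Lim (at_left 1) (\<lambda>\<rho>. lazy_curvature V E \<rho> x y / (1 - \<rho>))"

definition nonneg_LLY_curvature :: "'a set \<Rightarrow> 'a set set \<Rightarrow> bool" where
  "nonneg_LLY_curvature V E \<longleftrightarrow> (\<forall>x\<in>V. \<forall>y\<in>V. x \<noteq> y \<longrightarrow> 0 \<le> LLY_curvature V E x y)"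

end

theory Submission
  imports Defs
begin

text \<open>
  Curvature enters only through one inequality: if \<open>f\<close> is 1-Lipschitz and rises by 1 along an edge
  from \<open>x\<close> to \<open>y\<close>, then \<open>\<Delta>f(x) \<ge> \<Delta>f(y)\<close>. The quotients defining the curvature increase with \<open>\<rho>\<close>
  and, by the easy half of Kantorovich duality, are bounded by \<open>\<Delta>f(x) - \<Delta>f(y)\<close>.

  Suppose that a minimum cut has \<open>k < \<delta>\<close> edges. Among the minimum cuts choose one with a side \<open>X\<close> of
  least cardinality, so that moving vertices out of \<open>X\<close> strictly enlarges the cut, and let \<open>A\<close>, \<open>B\<close> be
  the end vertices of the cut edges in \<open>X\<close> and in its complement \<open>Y\<close>. For \<open>f\<close> the signed distance to
  \<open>A\<close> the curvature inequality on a cut edge bounds the degrees across the cut from below. Two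
  disjoint cut edges force equality, and then every vertex of \<open>A\<close> and \<open>B\<close> off these two edges lies on
  just one cut edge. Comparing, at each vertex, its degree across the cut with its degree
  away from the cut shows that the cut edges form two stars, with centres \<open>x \<in> A\<close> and \<open>y \<in> B\<close> that
  are not adjacent. A second test function gives \<open>k = 4\<close>, and moving \<open>A\<close> and one more vertex
  out of \<open>X\<close> does not enlarge the cut, a contradiction.
\<close>

section \<open>Edge boundaries\<close>

text \<open>A finite simple graph seen through its neighbourhoods, so that the counting is
  independent of the encoding of edges as two-element sets.\<close>

locale neighbourhoods =
  fixes V :: "'a set" and N :: "'a \<Rightarrow> 'a set"
  assumes finite_V: "finite V"
    and N_subset: "N x \<subseteq> V"
    and N_sym: "y \<in> N x \<Longrightarrow> x \<in> N y"
    and N_irrefl: "x \<notin> N x"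
begin

definition cut :: "'a set \<Rightarrow> nat" where
  "cut S = (\<Sum>x\<in>S. card (N x - S))"

definition boundary :: "'a set \<Rightarrow> 'a set" where
  "boundary S = {x\<in>S. N x - S \<noteq> {}}"

definition inner_degree :: "'a set \<Rightarrow> 'a \<Rightarrow> nat" where
  "inner_degree S x = card (N x \<inter> (S - boundary S))"

lemma finite_N [simp]: "finite (N x)"
  using finite_subset[OF N_subset finite_V] .

lemma N_commute: "y \<in> N x \<longleftrightarrow> x \<in> N y"
  using N_sym by blast

lemma boundary_subset: "boundary S \<subseteq> S"
  by (auto simp: boundary_def)

lemma double_count:
  assumes "finite S" "finite T"
  shows "(\<Sum>x\<in>S. card (N x \<inter> T)) = (\<Sum>y\<in>T. card (N y \<inter> S))"
proof -
  have *: "card (N x \<inter> T) = (\<Sum>y\<in>T. of_bool (y \<in> N x))" if "finite T" for x T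
    using that by (simp add: Int_commute Int_def)
  have "(\<Sum>x\<in>S. card (N x \<inter> T)) = (\<Sum>x\<in>S. \<Sum>y\<in>T. of_bool (y \<in> N x))"
    by (simp only: *[OF assms(2)])
  also have "\<dots> = (\<Sum>y\<in>T. \<Sum>x\<in>S. of_bool (y \<in> N x))"
    by (rule sum.swap)
  also have "\<dots> = (\<Sum>y\<in>T. \<Sum>x\<in>S. of_bool (x \<in> N y))"
    by (intro sum.cong refl arg_cong[where f = of_bool] N_commute)
  also have "\<dots> = (\<Sum>y\<in>T. card (N y \<inter> S))"
    by (intro sum.cong refl *[OF assms(1), symmetric])
  finally show ?thesis .
qed

lemma N_diff: "N x - S = N x \<inter> (V - S)"
  using N_subset by blast

lemma N_diff_compl: "N x - (V - S) = N x \<inter> S"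
  using N_subset by blast

lemma cut_compl:
  assumes "S \<subseteq> V"
  shows "cut (V - S) = cut S"
proof -
  have "finite S" using assms finite_V finite_subset by blast
  then show ?thesis
    unfolding cut_def N_diff_compl N_diff[of _ S]
    using double_count[of "V - S" S] finite_V by simp
qed

lemma cut_eq_sum_boundary:
  assumes "finite S"
  shows "cut S = (\<Sum>x\<in>boundary S. card (N x - S))"
  unfolding cut_def using assms boundary_subset
  by (intro sum.mono_neutral_right) (auto simp: boundary_def)

text \<open>When \<open>T\<close> leaves \<open>S\<close>, the edges from \<open>T\<close> to the
  outside of \<open>S\<close> drop out of the cut and those from \<open>T\<close> to
  \<open>S - T\<close> enter it. Both corrections are added, since subtraction on \<open>nat\<close>
  truncates.\<close>

lemma cut_move:
  assumes "T \<subseteq> S" "finite S"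
  shows "cut (S - T) + (\<Sum>t\<in>T. card (N t - S)) = cut S + (\<Sum>t\<in>T. card (N t \<inter> (S - T)))"
proof -
  have fin: "finite T" "finite (S - T)" using assms finite_subset by auto
  have "card (N x - (S - T)) = card (N x - S) + card (N x \<inter> T)" for x
  proof -
    have "N x - (S - T) = (N x - S) \<union> (N x \<inter> T)" using assms by blast
    then show ?thesis using assms by (auto intro!: card_Un_disjoint)
  qed
  then have "cut (S - T) = (\<Sum>x\<in>S - T. card (N x - S)) + (\<Sum>x\<in>S - T. card (N x \<inter> T))"
    unfolding cut_def by (simp add: sum.distrib)
  moreover have "(\<Sum>x\<in>S - T. card (N x \<inter> T)) = (\<Sum>t\<in>T. card (N t \<inter> (S - T)))"
    using double_count[OF fin(2,1)] .
  moreover have "cut S = (\<Sum>x\<in>S - T. card (N x - S)) + (\<Sum>t\<in>T. card (N t - S))"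
    unfolding cut_def by (rule sum.subset_diff) (use assms in auto)
  ultimately show ?thesis by simp
qed

lemma outer_degree_pos: "x \<in> boundary S \<Longrightarrow> 0 < card (N x - S)"
  by (auto simp: boundary_def card_gt_0_iff)

lemma card_boundary_le_cut:
  assumes "finite S"
  shows "card (boundary S) \<le> cut S"
proof -
  have "(\<Sum>x\<in>boundary S. 1) \<le> (\<Sum>x\<in>boundary S. card (N x - S))"
    by (intro sum_mono) (use outer_degree_pos in force)
  then show ?thesis using cut_eq_sum_boundary[OF assms] by simp
qed

lemma card_N_split:
  assumes "x \<in> boundary S"
  shows "card (N x) = card (N x - S) + card (N x \<inter> boundary S) + inner_degree S x"
proof -
  have "N x = ((N x - S) \<union> (N x \<inter> boundary S)) \<union> (N x \<inter> (S - boundary S))"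
    using boundary_subset by blast
  also have "card \<dots> = card ((N x - S) \<union> (N x \<inter> boundary S)) + inner_degree S x"
    unfolding inner_degree_def using boundary_subset by (intro card_Un_disjoint) auto
  also have "card ((N x - S) \<union> (N x \<inter> boundary S)) = card (N x - S) + card (N x \<inter> boundary S)"
    using boundary_subset by (intro card_Un_disjoint) auto
  finally show ?thesis .
qed

lemma card_N_boundary:
  assumes "x \<in> boundary S" "finite S"
  shows "card (N x \<inter> boundary S) + 1 \<le> card (boundary S)"
proof -
  have fin: "finite (boundary S)" using assms boundary_subset finite_subset by blast
  have "N x \<inter> boundary S \<subset> boundary S" using assms N_irrefl by blast
  then have "card (N x \<inter> boundary S) < card (boundary S)" by (rule psubset_card_mono[OF fin])
  then show ?thesis by simp
qed

text \<open>Every boundary vertex contributes at least 1 to \<open>cut S\<close>, so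
  \<open>cut S - card (boundary S)\<close> bounds the total excess over 1 at any two or three of
  them.\<close>

lemma outer_degree_excess:
  assumes "finite S" "x \<in> boundary S" "x' \<in> boundary S" "x \<noteq> x'"
  shows "card (N x - S) + card (N x' - S) + card (boundary S) \<le> cut S + 2"
    and "u \<in> boundary S \<Longrightarrow> u \<noteq> x \<Longrightarrow> u \<noteq> x' \<Longrightarrow>
      card (N x - S) + card (N x' - S) + card (boundary S) + card (N u - S) \<le> cut S + 3"
proof -
  have fin: "finite (boundary S)" using assms boundary_subset finite_subset by blast
  have *: "(\<Sum>u\<in>U. card (N u - S)) + card (boundary S) \<le> cut S + card U" if "U \<subseteq> boundary S" for U
  proof -
    have "(\<Sum>u\<in>boundary S - U. 1) \<le> (\<Sum>u\<in>boundary S - U. card (N u - S))"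
      by (intro sum_mono) (use outer_degree_pos in force)
    moreover have "cut S = (\<Sum>u\<in>boundary S - U. card (N u - S)) + (\<Sum>u\<in>U. card (N u - S))"
      using cut_eq_sum_boundary[OF assms(1)] sum.subset_diff[OF that fin] by metis
    moreover have "card (boundary S - U) = card (boundary S) - card U" "card U \<le> card (boundary S)"
      using that fin by (auto simp: card_Diff_subset finite_subset card_mono)
    ultimately show ?thesis by simp
  qed
  show "card (N x - S) + card (N x' - S) + card (boundary S) \<le> cut S + 2"
    using *[of "{x, x'}"] assms by simp
  show "card (N x - S) + card (N x' - S) + card (boundary S) + card (N u - S) \<le> cut S + 3"
    if "u \<in> boundary S" "u \<noteq> x" "u \<noteq> x'"
    using *[of "{u, x, x'}"] assms that by simp
qed

text \<open>If \<open>card S \<le> cut S\<close>, then each vertex, with degree above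
  \<open>cut S\<close> and at most \<open>card S - 1\<close> neighbours in \<open>S\<close>, sends
  out so many edges that their total exceeds \<open>cut S\<close>.\<close>

lemma cut_lt_imp_card:
  assumes "S \<noteq> {}" "finite S" "\<And>v. v \<in> S \<Longrightarrow> cut S < card (N v)"
  shows "cut S < card S"
proof (rule ccontr)
  assume "\<not> cut S < card S"
  then have le: "card S \<le> cut S" by simp
  define c where "c = cut S + 1"
  have "c \<le> card (N x - S) + (card S - 1)" if "x \<in> S" for x
  proof -
    have "N x \<subseteq> (N x - S) \<union> (S - {x})" using N_irrefl by blast
    then have "card (N x) \<le> card ((N x - S) \<union> (S - {x}))"
      using assms by (intro card_mono) auto
    also have "\<dots> \<le> card (N x - S) + card (S - {x})" by (rule card_Un_le)
    also have "card (S - {x}) = card S - 1" using that by simp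
    finally show ?thesis using assms(3)[OF that] by (simp add: c_def)
  qed
  then have "(\<Sum>x\<in>S. c) \<le> (\<Sum>x\<in>S. card (N x - S) + (card S - 1))"
    by (intro sum_mono) auto
  then have "card S * c \<le> cut S + card S * (card S - 1)"
    by (simp add: cut_def sum.distrib)
  moreover obtain m where m: "card S = Suc m"
    using assms by (metis card_gt_0_iff gr0_implies_Suc)
  obtain j where "cut S = Suc m + j" using le m by (metis le_Suc_ex)
  ultimately show False using m by (simp add: c_def algebra_simps)
qed

end

section \<open>Integer arithmetic for the curvature inequality\<close>

lemma sum_of_bool_card: "finite A \<Longrightarrow> (\<Sum>v\<in>A. of_bool (P v)) = int (card {v\<in>A. P v})"
  by (simp add: Int_def)

text \<open>Divided by \<open>a * b\<close>, the last hypothesis reads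
  \<open>p / a + q / b \<ge> 2\<close>. Lowering both denominators to \<open>c\<close> can only
  increase the left side, strictly unless both already equal \<open>c\<close>.\<close>

lemma weighted_ineq:
  fixes p q a b c :: int
  assumes "0 < p" "0 < q" "0 < c" "c \<le> a" "c \<le> b" "2 * a * b \<le> p * b + q * a"
  shows "2 * c \<le> p + q" and "p + q \<le> 2 * c \<Longrightarrow> a = c \<and> b = c"
proof -
  have pos: "a > 0" "b > 0" using assms by auto
  have 1: "p * b * c + q * a * c \<le> (p + q) * (a * b)"
  proof -
    have "p * b * c \<le> p * b * a" "q * a * c \<le> q * a * b"
      using assms pos by (auto intro!: mult_left_mono)
    then show ?thesis by (simp add: algebra_simps)
  qed
  have 2: "2 * a * b * c \<le> p * b * c + q * a * c"
    using mult_right_mono[OF assms(6), of c] assms(3) by (simp add: algebra_simps)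
  have "(2 * c) * (a * b) \<le> (p + q) * (a * b)" using 1 2 by (simp add: algebra_simps)
  then show le: "2 * c \<le> p + q" using pos by (simp add: mult_le_cancel_right)
  assume "p + q \<le> 2 * c"
  then have eq: "p + q = 2 * c" using le by simp
  have "p * b * (a - c) + q * a * (b - c) \<le> 0"
  proof -
    have "(p + q) * (a * b) = 2 * a * b * c" using eq by simp
    then show ?thesis using 2 by (simp add: algebra_simps)
  qed
  moreover have "0 \<le> p * b * (a - c)" "0 \<le> q * a * (b - c)" using assms pos by auto
  ultimately have "p * b * (a - c) = 0" "q * a * (b - c) = 0" by linarith+
  then show "a = c \<and> b = c" using assms pos by auto
qed

section \<open>A minimum cut with a smallest side\<close>

text \<open>The configuration to be refuted. \<open>curvature\<close> compares the Laplacians of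
  \<open>f\<close> at \<open>x\<close> and \<open>y\<close> after multiplication by both degrees,
  which keeps it over the integers; \<open>atom\<close> is what a smallest side \<open>X\<close>
  gains over a mere minimum cut.\<close>

locale small_cut_atom = neighbourhoods +
  fixes X :: "'a set"
  assumes curvature: "\<And>(f :: 'a \<Rightarrow> int) x y. y \<in> N x \<Longrightarrow> (\<And>u v. v \<in> N u \<Longrightarrow> f v - f u \<le> 1) \<Longrightarrow>
      f y - f x = 1 \<Longrightarrow>
      (\<Sum>v\<in>N y. f v - f y) * int (card (N x)) \<le> (\<Sum>v\<in>N x. f v - f x) * int (card (N y))"
    and X: "X \<subset> V" "X \<noteq> {}"
    and cut_pos: "0 < cut X"
    and cut_lt_degree: "v \<in> V \<Longrightarrow> cut X < card (N v)"
    and cut_min: "S \<subset> V \<Longrightarrow> S \<noteq> {} \<Longrightarrow> cut X \<le> cut S"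
    and atom: "S \<subset> X \<Longrightarrow> S \<noteq> {} \<Longrightarrow> cut X < cut S"
begin

definition "Y = V - X"

abbreviation "d v \<equiv> card (N v)"
abbreviation "k \<equiv> cut X"
abbreviation "A \<equiv> boundary X"
abbreviation "B \<equiv> boundary Y"
text \<open>Degrees across the cut: \<open>e\<close> for vertices of \<open>X\<close>,
  \<open>e'\<close> for vertices of \<open>Y\<close>.\<close>

abbreviation "e v \<equiv> card (N v - X)"
abbreviation "e' v \<equiv> card (N v - Y)"

lemma finite_sides: "finite X" "finite Y" "finite A" "finite B"
proof -
  show "finite X" "finite Y" using X finite_V finite_subset by (auto simp: Y_def)
  then show "finite A" "finite B" using boundary_subset finite_subset by blast+
qed

lemma cut_Y: "cut Y = k"
  unfolding Y_def using cut_compl X by blast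

lemma cut_edge_ends:
  assumes "x \<in> X" "y \<in> N x - X"
  shows "x \<in> A" "y \<in> B" "x \<in> N y - Y" "y \<in> Y" "y \<notin> X" "x \<notin> Y"
  using assms N_sym[of y x] N_subset[of x] by (auto simp: boundary_def Y_def)

lemma cut_edge_ends':
  assumes "y \<in> Y" "x \<in> N y - Y"
  shows "x \<in> X" "y \<in> N x - X"
  using assms N_sym[of x y] N_subset[of y] by (auto simp: boundary_def Y_def)

text \<open>By \<open>atom\<close>, taking \<open>T\<close> out of \<open>X\<close> enlarges the cut
  strictly, and \<open>cut_move\<close> turns this into a comparison of degrees. For
  \<open>Y\<close> only \<open>cut_min\<close> is available, hence the weak inequality in
  \<open>move_Y\<close>.\<close>

lemma move_X:
  assumes "T \<subset> X" "T \<noteq> {}"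
  shows "(\<Sum>t\<in>T. e t) < (\<Sum>t\<in>T. card (N t \<inter> (X - T)))"
proof -
  have "k < cut (X - T)" using assms by (intro atom) auto
  moreover have "cut (X - T) + (\<Sum>t\<in>T. e t) = k + (\<Sum>t\<in>T. card (N t \<inter> (X - T)))"
    using cut_move[of T X] assms finite_sides by auto
  ultimately show ?thesis by linarith
qed

lemma move_Y:
  assumes "T \<subset> Y" "T \<noteq> {}"
  shows "(\<Sum>t\<in>T. e' t) \<le> (\<Sum>t\<in>T. card (N t \<inter> (Y - T)))"
proof -
  have "k \<le> cut (Y - T)" using assms X by (intro cut_min) (auto simp: Y_def)
  moreover have "cut (Y - T) + (\<Sum>t\<in>T. e' t) = k + (\<Sum>t\<in>T. card (N t \<inter> (Y - T)))"
    using cut_move[of T Y] assms finite_sides cut_Y by auto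
  ultimately show ?thesis by linarith
qed

lemma A_psubset: "A \<subset> X"
proof -
  have "k < card X"
    by (rule cut_lt_imp_card) (use X finite_sides cut_lt_degree in auto)
  then have "A \<noteq> X" using card_boundary_le_cut[OF finite_sides(1)] by auto
  then show ?thesis using boundary_subset by blast
qed

lemma B_psubset: "B \<subset> Y"
proof -
  have "cut Y < card Y"
    by (rule cut_lt_imp_card) (use X finite_sides cut_lt_degree cut_Y in \<open>auto simp: Y_def\<close>)
  then have "B \<noteq> Y" using card_boundary_le_cut[OF finite_sides(2)] by auto
  then show ?thesis using boundary_subset by blast
qed

lemma A_nonempty: "A \<noteq> {}"
  using cut_pos cut_eq_sum_boundary[OF finite_sides(1)] by (metis less_numeral_extra(3) sum.empty)

lemma B_nonempty: "B \<noteq> {}"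
  using cut_pos cut_eq_sum_boundary[OF finite_sides(2)] cut_Y by (metis less_numeral_extra(3) sum.empty)

section \<open>Cut edges under the curvature inequality\<close>

text \<open>From \<open>x\<close> the test function rises by 1 to each neighbour across the cut and
  drops by 1 to each inner neighbour; at \<open>y\<close> the signs are exchanged. Neighbours on the
  same boundary contribute 0.\<close>

lemma crossing_edge:
  assumes "x \<in> X" "y \<in> N x - X"
  shows "(int (inner_degree Y y) - int (e' y)) * int (d x) \<le> (int (e x) - int (inner_degree X x)) * int (d y)"
proof -
  \<comment> \<open>the signed distance to \<open>A\<close>, truncated to \<open>{-1..2}\<close>\<close>
  define f :: "'a \<Rightarrow> int" where
    "f v = (if v \<in> X then if v \<in> A then 0 else -1 else if v \<in> B then 1 else 2)" for v
  note c = cut_edge_ends[OF assms]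
  have lip: "f v - f u \<le> 1" if "v \<in> N u" for u v
  proof (cases "u \<in> X \<and> v \<notin> X")
    case True
    then show ?thesis using that cut_edge_ends[of u v] by (simp add: f_def)
  next
    case False
    then show ?thesis by (auto simp: f_def)
  qed
  have "f v - f x = of_bool (v \<notin> X) - of_bool (v \<in> X - A)" if "v \<in> N x" for v
  proof (cases "v \<in> X")
    case True
    then show ?thesis using assms(1) c(1) by (simp add: f_def)
  next
    case False
    then have "v \<in> B" using cut_edge_ends(2)[of x v] assms(1) that by simp
    then show ?thesis using False assms(1) c(1) by (simp add: f_def)
  qed
  then have "(\<Sum>v\<in>N x. f v - f x) = (\<Sum>v\<in>N x. of_bool (v \<notin> X) - of_bool (v \<in> X - A))"
    by (intro sum.cong refl)
  also have "\<dots> = int (e x) - int (inner_degree X x)"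
    unfolding sum_subtractf sum_of_bool_card[OF finite_N] inner_degree_def
    by (intro arg_cong2[where f = minus] arg_cong[where f = int] arg_cong[where f = card]) auto
  finally have sx: "(\<Sum>v\<in>N x. f v - f x) = int (e x) - int (inner_degree X x)" .
  have "f v - f y = of_bool (v \<in> Y - B) - of_bool (v \<notin> Y)" if "v \<in> N y" for v
  proof (cases "v \<in> Y")
    case True
    then have "v \<notin> X" by (simp add: Y_def)
    then show ?thesis using True c(2,5) by (simp add: f_def)
  next
    case False
    then have "v \<in> X" "y \<in> N v - X" using cut_edge_ends'[of y v] c(4) that by blast+
    then show ?thesis using False cut_edge_ends(1)[of v y] c(2,5) by (simp add: f_def)
  qed
  then have "(\<Sum>v\<in>N y. f v - f y) = (\<Sum>v\<in>N y. of_bool (v \<in> Y - B) - of_bool (v \<notin> Y))"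
    by (intro sum.cong refl)
  also have "\<dots> = int (inner_degree Y y) - int (e' y)"
    unfolding sum_subtractf sum_of_bool_card[OF finite_N] inner_degree_def
    by (intro arg_cong2[where f = minus] arg_cong[where f = int] arg_cong[where f = card]) auto
  finally have sy: "(\<Sum>v\<in>N y. f v - f y) = int (inner_degree Y y) - int (e' y)" .
  have "f y - f x = 1" using c(1,2,5) assms(1) by (simp add: f_def)
  then show ?thesis
    using curvature[of y x f] lip assms(2) sx sy by simp
qed

text \<open>Eliminating the inner degrees by \<open>card_N_split\<close> puts
  \<open>crossing_edge\<close> into the form of \<open>weighted_ineq\<close> with
  \<open>c = k + 1\<close>, a lower bound for all degrees. A vertex of \<open>A\<close> has at most
  \<open>card A - 1\<close> neighbours in \<open>A\<close>, and likewise for \<open>B\<close>; in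
  the equality case all these bounds are attained.\<close>

lemma crossing_edge_sum:
  assumes "x \<in> X" "y \<in> N x - X"
  shows "2 * k + 4 \<le> 2 * e x + card A + 2 * e' y + card B"
    and "2 * e x + card A + 2 * e' y + card B \<le> 2 * k + 4 \<Longrightarrow>
      d x = k + 1 \<and> d y = k + 1 \<and> card (N x \<inter> A) + 1 = card A \<and> card (N y \<inter> B) + 1 = card B"
proof -
  note c = cut_edge_ends[OF assms]
  let ?p = "int (2 * e x + card (N x \<inter> A))" and ?q = "int (2 * e' y + card (N y \<inter> B))"
  note split = card_N_split[OF c(1)] card_N_split[OF c(2)]
  note bds = card_N_boundary[OF c(1) finite_sides(1)] card_N_boundary[OF c(2) finite_sides(2)]
  have eqs: "int (e x) - int (inner_degree X x) = ?p - int (d x)" "int (inner_degree Y y) - int (e' y) = int (d y) - ?q"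
    using split by simp_all
  have ineq: "2 * int (d x) * int (d y) \<le> ?p * int (d y) + ?q * int (d x)"
    using crossing_edge[OF assms] unfolding eqs left_diff_distrib by (simp only: mult_ac)
  have V: "x \<in> V" "y \<in> V" using c assms X by (auto simp: Y_def)
  have deg: "int (k + 1) \<le> int (d x)" "int (k + 1) \<le> int (d y)"
    using cut_lt_degree V by force+
  have pos: "0 < ?p" "0 < ?q" "0 < int (k + 1)"
    using outer_degree_pos[OF c(1)] outer_degree_pos[OF c(2)] by linarith+
  note w = weighted_ineq[OF pos deg ineq]
  have le: "2 * k + 2 \<le> (2 * e x + card (N x \<inter> A)) + (2 * e' y + card (N y \<inter> B))"
    using w(1) unfolding of_nat_le_iff[symmetric, where 'a = int] by simp
  show "2 * k + 4 \<le> 2 * e x + card A + 2 * e' y + card B"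
    using le bds by linarith
  assume a: "2 * e x + card A + 2 * e' y + card B \<le> 2 * k + 4"
  then have "(2 * e x + card (N x \<inter> A)) + (2 * e' y + card (N y \<inter> B)) \<le> 2 * k + 2"
    using bds by linarith
  then have "?p + ?q \<le> 2 * int (k + 1)"
    unfolding of_nat_le_iff[symmetric, where 'a = int] by simp
  then have "d x = k + 1 \<and> d y = k + 1"
    using w(2) by (simp only: of_nat_eq_iff)
  then show "d x = k + 1 \<and> d y = k + 1 \<and> card (N x \<inter> A) + 1 = card A \<and> card (N y \<inter> B) + 1 = card B"
    using le bds a by linarith
qed

text \<open>The lower bounds of \<open>crossing_edge_sum\<close> for the two edges add up to
  \<open>4 * k + 8\<close>. This is also twice the sum of the upper bounds that
  \<open>outer_degree_excess\<close> gives on the two sides, so every one of these bounds is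
  attained.\<close>

lemma disjoint_crossing_edges:
  assumes "x \<in> X" "y \<in> N x - X" "x' \<in> X" "y' \<in> N x' - X" "x \<noteq> x'" "y \<noteq> y'"
  shows "e x + e x' + card A = k + 2" "e' y + e' y' + card B = k + 2"
    and "2 * e x + card A + 2 * e' y + card B = 2 * k + 4"
    and "d x = k + 1" "d y = k + 1" "card (N x \<inter> A) + 1 = card A" "card (N y \<inter> B) + 1 = card B"
    and "u \<in> A \<Longrightarrow> u \<noteq> x \<Longrightarrow> u \<noteq> x' \<Longrightarrow> e u = 1"
    and "v \<in> B \<Longrightarrow> v \<noteq> y \<Longrightarrow> v \<noteq> y' \<Longrightarrow> e' v = 1"
proof -
  note c = cut_edge_ends[OF assms(1,2)] and c' = cut_edge_ends[OF assms(3,4)]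
  note X1 = outer_degree_excess(1)[OF finite_sides(1) c(1) c'(1) assms(5)]
    and Y1 = outer_degree_excess(1)[OF finite_sides(2) c(2) c'(2) assms(6), unfolded cut_Y]
  note s = crossing_edge_sum(1)[OF assms(1,2)] crossing_edge_sum(1)[OF assms(3,4)]
  show 1: "e x + e x' + card A = k + 2" and 2: "e' y + e' y' + card B = k + 2"
    and 3: "2 * e x + card A + 2 * e' y + card B = 2 * k + 4"
    using X1 Y1 s by linarith+
  show "d x = k + 1" "d y = k + 1" "card (N x \<inter> A) + 1 = card A" "card (N y \<inter> B) + 1 = card B"
    using crossing_edge_sum(2)[OF assms(1,2)] 3 by simp_all
  show "e u = 1" if "u \<in> A" "u \<noteq> x" "u \<noteq> x'"
    using outer_degree_excess(2)[OF finite_sides(1) c(1) c'(1) assms(5) that] 1 outer_degree_pos[OF that(1)] by linarith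
  show "e' v = 1" if "v \<in> B" "v \<noteq> y" "v \<noteq> y'"
    using outer_degree_excess(2)[OF finite_sides(2) c(2) c'(2) assms(6) that] 2 cut_Y outer_degree_pos[OF that(1)] by linarith
qed

lemma degree_pos: "x \<in> V \<Longrightarrow> 0 < d x"
  using cut_lt_degree by fastforce

lemma crossing_edge_sign:
  assumes "x \<in> X" "y \<in> N x - X"
  shows "e x < inner_degree X x \<Longrightarrow> inner_degree Y y < e' y"
    and "e' y < inner_degree Y y \<Longrightarrow> inner_degree X x < e x"
proof -
  have "x \<in> V" "y \<in> V" using assms X N_subset by blast+
  then have d: "0 < int (d x)" "0 < int (d y)" using degree_pos by auto
  note ineq = crossing_edge[OF assms]
  show "inner_degree Y y < e' y" if "e x < inner_degree X x"
  proof -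
    have "(int (e x) - int (inner_degree X x)) * int (d y) < 0"
      using that d by (intro mult_neg_pos) auto
    then have "(int (inner_degree Y y) - int (e' y)) * int (d x) < 0" using ineq by linarith
    then show ?thesis using d by (simp add: mult_less_0_iff)
  qed
  show "inner_degree X x < e x" if "e' y < inner_degree Y y"
  proof -
    have "0 < (int (inner_degree Y y) - int (e' y)) * int (d x)"
      using that d by (intro mult_pos_pos) auto
    then have "0 < (int (e x) - int (inner_degree X x)) * int (d y)" using ineq by linarith
    then show ?thesis using d by (simp add: zero_less_mult_iff)
  qed
qed

text \<open>Of at least \<open>k + 1\<close> neighbours one lies across the cut and at most
  \<open>card A - 1\<close> lie in \<open>A\<close>; the others are inner.\<close>

lemma inner_degree_ge_X:
  assumes "u \<in> A" "e u = 1"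
  shows "k + 1 \<le> inner_degree X u + card A"
proof -
  have "u \<in> V" using assms boundary_subset X by blast
  then show ?thesis
    using card_N_split[OF assms(1)] card_N_boundary[OF assms(1) finite_sides(1)] cut_lt_degree[of u] assms(2)
    by linarith
qed

lemma inner_degree_ge_Y:
  assumes "v \<in> B" "e' v = 1"
  shows "k + 1 \<le> inner_degree Y v + card B"
proof -
  have "v \<in> V" using assms boundary_subset Y_def by blast
  then show ?thesis
    using card_N_split[OF assms(1)] card_N_boundary[OF assms(1) finite_sides(2)] cut_lt_degree[of v] assms(2)
    by linarith
qed

section \<open>Structure of the cut edges\<close>

lemma two_stars:
  obtains x y a where "x \<in> A" "y \<in> B" "y \<notin> N x" "3 \<le> a" "card A = a" "card B = a" "k + 2 = 2 * a"
    and "N x - X = B - {y}" "N y - Y = A - {x}"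
    and "\<And>u. u \<in> A \<Longrightarrow> d u = k + 1" "d y = k + 1"
    and "\<And>u. u \<in> A \<Longrightarrow> u \<noteq> x \<Longrightarrow> N u - X = {y}"
    and "\<And>u. u \<in> A \<Longrightarrow> u \<noteq> x \<Longrightarrow> inner_degree X u + 1 = a" "inner_degree X x = 1"
proof -
  \<comment> \<open>By \<open>crossing_edge_sign\<close> the vertices with more neighbours across the cut than inside
    alternate with those having fewer, which yields the disjoint edges \<open>x1 y\<close> and \<open>x y1\<close>.\<close>
  have "(\<Sum>u\<in>A. e u) < (\<Sum>u\<in>A. inner_degree X u)"
    unfolding inner_degree_def using move_X[OF A_psubset A_nonempty] .
  then obtain x1 where x1: "x1 \<in> A" "e x1 < inner_degree X x1"
    by (meson not_le sum_mono)
  then obtain y where y: "y \<in> N x1 - X" by (auto simp: boundary_def)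
  have x1X: "x1 \<in> X" using x1 boundary_subset by blast
  note c1 = cut_edge_ends[OF x1X y]
  have ysign: "inner_degree Y y < e' y" using crossing_edge_sign(1)[OF x1X y x1(2)] .
  have "(\<Sum>v\<in>B. e' v) \<le> (\<Sum>v\<in>B. inner_degree Y v)"
    unfolding inner_degree_def using move_Y[OF B_psubset B_nonempty] .
  \<comment> \<open>The weak inequality suffices: at \<open>y\<close> the inner degree is the
    smaller one, so somewhere in \<open>B\<close> it must be the larger one.\<close>
  then have "\<not> (\<forall>v\<in>B. inner_degree Y v \<le> e' v)"
    using sum_strict_mono_ex1[OF finite_sides(4), of "inner_degree Y" e'] c1(2) ysign leD by blast
  then obtain y1 where y1: "y1 \<in> B" "e' y1 < inner_degree Y y1"
    by force
  then obtain x where x: "x \<in> N y1 - Y" by (auto simp: boundary_def)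
  have y1Y: "y1 \<in> Y" using y1 boundary_subset by blast
  note c0 = cut_edge_ends'[OF y1Y x]
  note c2 = cut_edge_ends[OF c0]
  have xsign: "inner_degree X x < e x" using crossing_edge_sign(2)[OF c0 y1(2)] .
  have ne: "x1 \<noteq> x" "y \<noteq> y1" using x1 xsign y1 ysign by auto
  note D = disjoint_crossing_edges[OF x1X y c0 ne]
  note D' = disjoint_crossing_edges[OF c0 x1X y not_sym[OF ne(1)] not_sym[OF ne(2)]]
  have le_k: "card A \<le> k" "card B \<le> k"
    using card_boundary_le_cut[OF finite_sides(1)] card_boundary_le_cut[OF finite_sides(2)] cut_Y by auto
  \<comment> \<open>A second such vertex also differs from \<open>y1\<close>, so it lies on just one
    cut edge, and \<open>inner_degree_ge_Y\<close> with \<open>card B \<le> k\<close> gives it an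
    inner neighbour.\<close>
  have y_only: "v = y" if "v \<in> B" "inner_degree Y v < e' v" for v
  proof (rule ccontr)
    assume "v \<noteq> y"
    then have "e' v = 1" using D(9)[of v] that y1(2) by force
    then show False using inner_degree_ge_Y[of v] that le_k by linarith
  qed
  have x_only: "u = x" if "u \<in> A" "inner_degree X u < e u" for u
  proof (rule ccontr)
    assume "u \<noteq> x"
    then have "e u = 1" using D(8)[of u] that x1(2) by force
    then show False using inner_degree_ge_X[of u] that le_k by linarith
  qed
  \<comment> \<open>By \<open>crossing_edge_sign\<close> every cut edge at \<open>u\<close> ends in
    a vertex of the opposite kind, and \<open>y\<close> is the only one in \<open>B\<close>.\<close>
  have star_y: "N u - X = {y}" if "u \<in> A" "e u < inner_degree X u" for u
  proof -
    have "v = y" if v: "v \<in> N u - X" for v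
    proof -
      have "u \<in> X" using \<open>u \<in> A\<close> boundary_subset by blast
      then show ?thesis
        using y_only cut_edge_ends(2)[OF _ v] crossing_edge_sign(1)[OF _ v] that \<open>e u < inner_degree X u\<close> by blast
    qed
    moreover have "N u - X \<noteq> {}" using that by (auto simp: boundary_def)
    ultimately show ?thesis by blast
  qed
  have star_x: "N v - Y = {x}" if "v \<in> B" "e' v < inner_degree Y v" for v
  proof -
    have "u = x" if u: "u \<in> N v - Y" for u
    proof -
      have "v \<in> Y" using \<open>v \<in> B\<close> boundary_subset by blast
      note c = cut_edge_ends'[OF this u]
      show ?thesis
        using x_only cut_edge_ends(1)[OF c] crossing_edge_sign(2)[OF c] \<open>e' v < inner_degree Y v\<close> by blast
    qed
    moreover have "N v - Y \<noteq> {}" using that by (auto simp: boundary_def)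
    ultimately show ?thesis by blast
  qed
  have e1: "e x1 = 1" "e' y1 = 1" using star_y[OF x1] star_x[OF y1] by simp_all
  have ex: "e x + card A = k + 1" and ey: "e' y + card B = k + 1" using D(1,2) e1 by simp_all
  have "e x \<noteq> 1" using inner_degree_ge_X[OF c2(1)] xsign le_k by linarith
  then have ex2: "2 \<le> e x" using xsign by linarith
  have "e' y \<noteq> 1" using inner_degree_ge_Y[OF c1(2)] ysign le_k by linarith
  then have ey2: "2 \<le> e' y" using ysign by linarith
  have LA: "N u - X = {y}" if "u \<in> A" "u \<noteq> x" for u
  proof -
    have "e u = 1" using D(8)[of u] that e1 by force
    then have "e u < inner_degree X u" using inner_degree_ge_X[of u] that ex ex2 by linarith
    then show ?thesis using star_y that by blast
  qed
  have LB: "N v - Y = {x}" if "v \<in> B" "v \<noteq> y" for v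
  proof -
    have "e' v = 1" using D(9)[of v] that e1 by force
    then have "e' v < inner_degree Y v" using inner_degree_ge_Y[of v] that ey ey2 by linarith
    then show ?thesis using star_x that by blast
  qed
  have card_eq: "card A = card B" using D(3) e1 ey by linarith
  have NxB: "N x - X \<subseteq> B" using cut_edge_ends(2)[OF c0(1)] by blast
  have BNx: "B - {y} \<subseteq> N x - X"
  proof
    fix v assume v: "v \<in> B - {y}"
    then have "x \<in> N v - Y" "v \<in> Y" using LB boundary_subset by blast+
    then show "v \<in> N x - X" using cut_edge_ends'(2) by blast
  qed
  have dx: "d x = k + 1" and dy: "d y = k + 1" using D'(4) D(5) .
  \<comment> \<open>If \<open>x\<close> and \<open>y\<close> were adjacent, exactly half of the
    \<open>k + 1\<close> neighbours of \<open>x\<close> would lie across the cut, and moving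
    \<open>x\<close> out of \<open>X\<close> would not enlarge it.\<close>
  have yNx: "y \<notin> N x"
  proof
    assume "y \<in> N x"
    then have "N x - X = B" using NxB BNx c1(5) by blast
    then have *: "e x = card A" using card_eq by simp
    have "{x} \<subset> X" using A_psubset c2(1) by blast
    then have "e x < card (N x \<inter> (X - {x}))" using move_X[of "{x}"] by simp
    also have "N x \<inter> (X - {x}) = N x - (N x - X)" using N_irrefl by blast
    also have "card (N x - (N x - X)) = d x - e x" by (intro card_Diff_subset) auto
    finally show False using dx * ex by linarith
  qed
  have Nx: "N x - X = B - {y}" using NxB BNx yNx by blast
  have Ny: "N y - Y = A - {x}"
  proof
    show "N y - Y \<subseteq> A - {x}"
      using cut_edge_ends'[OF c1(4)] cut_edge_ends(1) yNx N_commute by blast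
    show "A - {x} \<subseteq> N y - Y"
    proof
      fix u assume u: "u \<in> A - {x}"
      then have "y \<in> N u - X" "u \<in> X" using LA boundary_subset by blast+
      then show "u \<in> N y - Y" using cut_edge_ends(3) by blast
    qed
  qed
  have "e x + 1 = card B" unfolding Nx using c1(2) finite_sides(4) card_Suc_Diff1 by fastforce
  then have ka: "k + 2 = 2 * card A" and a3: "3 \<le> card A" using ex ex2 card_eq by linarith+
  \<comment> \<open>The edge from a leaf \<open>u\<close> to \<open>y\<close> is disjoint from the
    edge \<open>x y1\<close>, so the equality case is available at every leaf.\<close>
  have L: "d u = k + 1" "inner_degree X u + 1 = card A" if "u \<in> A" "u \<noteq> x" for u
  proof -
    have u: "u \<in> X" "y \<in> N u - X" using LA[OF that] that boundary_subset by blast+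
    note E = disjoint_crossing_edges[OF u c0 that(2) ne(2)]
    show "d u = k + 1" by (rule E(4))
    show "inner_degree X u + 1 = card A"
      using card_N_split[OF that(1)] E(4,6) LA[OF that] ka by simp
  qed
  have "inner_degree X x = 1" using card_N_split[OF c2(1)] D'(4,6) ka ex by linarith
  moreover have "d u = k + 1" if "u \<in> A" for u using L(1)[OF that] dx by blast
  ultimately show thesis
    using that[OF c2(1) c1(2) yNx a3 refl _ ka Nx Ny _ dy LA L(2)] card_eq by simp
qed

theorem no_small_cut_atom: False
proof -
  obtain x y a where xA: "x \<in> A" and yB: "y \<in> B" and yNx: "y \<notin> N x" and a3: "3 \<le> a"
    and card_A: "card A = a" and card_B: "card B = a" and ka: "k + 2 = 2 * a"
    and Nx: "N x - X = B - {y}" and Ny: "N y - Y = A - {x}"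
    and dA: "\<And>u. u \<in> A \<Longrightarrow> d u = k + 1" and dy: "d y = k + 1"
    and NA: "\<And>u. u \<in> A \<Longrightarrow> u \<noteq> x \<Longrightarrow> N u - X = {y}"
    and innA: "\<And>u. u \<in> A \<Longrightarrow> u \<noteq> x \<Longrightarrow> inner_degree X u + 1 = a" and innx: "inner_degree X x = 1"
    using two_stars by blast
  have AX: "u \<in> X" if "u \<in> A" for u using that boundary_subset by blast
  have yX: "y \<notin> X" using yB boundary_subset by (auto simp: Y_def)
  have xNy: "x \<notin> N y" using yNx N_commute by blast
  obtain z where z: "N x \<inter> (X - A) = {z}"
    using innx by (auto simp: inner_degree_def card_1_singleton_iff)
  then have zx: "z \<in> N x" and zX: "z \<in> X" and zA: "z \<notin> A" by blast+
  define D where "D = X - A - {z}"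
  \<comment> \<open>rises by 1 along each edge from a leaf \<open>l \<in> A - {x}\<close> to \<open>y\<close> and along the edge from \<open>z\<close> to \<open>x\<close>\<close>
  define f :: "'a \<Rightarrow> int" where
    "f v = (if v = x \<or> v = y then 0 else if v \<notin> X then 1 else if v \<in> D then -2 else -1)" for v
  have xy: "x \<noteq> y" "x \<notin> D" "z \<notin> D" "z \<noteq> x" "z \<noteq> y" "y \<notin> D" "y \<notin> A"
    using xA yX AX zA zX by (auto simp: D_def)
  have xD: "N x \<inter> D = {}" using z by (auto simp: D_def)
  have f_le: "f v \<le> 1" "v \<in> X \<Longrightarrow> f v \<le> 0" "v \<notin> X \<Longrightarrow> 0 \<le> f v" "- 2 \<le> f v"
    "v \<notin> D \<Longrightarrow> -1 \<le> f v" "v \<in> X \<Longrightarrow> v \<noteq> x \<Longrightarrow> f v \<le> -1" for v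
    using xA AX yX xy by (auto simp: f_def D_def)
  \<comment> \<open>Inside \<open>X\<close> the value 0 is taken only at \<open>x\<close>, which has
    no neighbour in \<open>D\<close>. A leaf has \<open>y\<close> as its only neighbour outside
    \<open>X\<close>, and \<open>f\<close> is 0 there rather than 1.\<close>
  have lip: "f v - f u \<le> 1" if "v \<in> N u" for u v
  proof -
    consider "u \<in> X" "v \<in> X" "v = x" | "u \<in> X" "v \<in> X" "v \<noteq> x" | "u \<in> X" "v \<notin> X" "u = x"
      | "u \<in> X" "v \<notin> X" "u \<noteq> x" | "u \<notin> X" by blast
    then show ?thesis
    proof cases
      case 1
      then have "u \<notin> D" using xD that N_commute by blast
      then show ?thesis using f_le(5)[of u] 1 by (simp add: f_def)
    next
      case 2
      then show ?thesis using f_le(6)[of v] f_le(4)[of u] by linarith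
    next
      case 3
      then show ?thesis using f_le(1)[of v] by (simp add: f_def)
    next
      case 4
      then have uA: "u \<in> A" using that by (auto simp: boundary_def)
      then have "v = y" using NA[OF uA 4(3)] that 4 by blast
      moreover have "u \<notin> D" using uA by (simp add: D_def)
      ultimately show ?thesis using f_le(5)[of u] by (simp add: f_def)
    next
      case 5
      then show ?thesis using f_le(3)[of u] f_le(1)[of v] by linarith
    qed
  qed
  have cardNx: "e x + 1 = a" unfolding Nx using yB finite_sides(4) card_B card_Suc_Diff1 by fastforce
  have cardNy: "e' y + 1 = a" unfolding Ny using xA finite_sides(3) card_A card_Suc_Diff1 by fastforce
  \<comment> \<open>Of the \<open>2 * a - 1\<close> neighbours of \<open>y\<close>, the
    \<open>a - 1\<close> leaves have value -1 and all others 1.\<close>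
  have sum_y: "(\<Sum>v\<in>N y. f v - f y) = 1"
  proof -
    have "(\<Sum>v\<in>N y. f v - f y) = (\<Sum>v\<in>N y. 1 - 2 * of_bool (v \<notin> Y))"
    proof (intro sum.cong refl)
      fix v assume v: "v \<in> N y"
      then have "v \<noteq> x" "v \<noteq> y" using xNy N_irrefl by blast+
      moreover have "v \<in> A" if "v \<notin> Y" using v Ny that by blast
      moreover have "v \<notin> X" if "v \<in> Y" using that by (simp add: Y_def)
      ultimately show "f v - f y = 1 - 2 * of_bool (v \<notin> Y)"
        using AX by (auto simp: f_def D_def)
    qed
    also have "\<dots> = int (d y) - 2 * int (card {v \<in> N y. v \<notin> Y})"
      unfolding sum_subtractf sum_distrib_left[symmetric] sum_of_bool_card[OF finite_N] by simp
    also have "{v \<in> N y. v \<notin> Y} = N y - Y" by blast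
    finally show ?thesis using dy cardNy ka by linarith
  qed
  have sum_x: "(\<Sum>v\<in>N x. f v - f x) = -1"
  proof -
    have "(\<Sum>v\<in>N x. f v - f x) = (\<Sum>v\<in>N x. 2 * of_bool (v \<notin> X) - 1)"
    proof (intro sum.cong refl)
      fix v assume v: "v \<in> N x"
      then have "v \<noteq> x" "v \<noteq> y" "v \<notin> D" using yNx N_irrefl xD by blast+
      then show "f v - f x = 2 * of_bool (v \<notin> X) - 1"
        by (auto simp: f_def)
    qed
    also have "\<dots> = 2 * int (card {v \<in> N x. v \<notin> X}) - int (d x)"
      unfolding sum_subtractf sum_distrib_left[symmetric] sum_of_bool_card[OF finite_N] by simp
    also have "{v \<in> N x. v \<notin> X} = N x - X" by blast
    finally show ?thesis using dA[OF xA] cardNx ka by linarith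
  qed
  \<comment> \<open>From \<open>l\<close> the function rises by 1 to \<open>y\<close> and possibly
    to \<open>x\<close>, and drops by 1 to each neighbour in \<open>D\<close>. As \<open>l\<close>
    and \<open>y\<close> have equal degrees, curvature makes the sum at \<open>l\<close> at least
    the sum at \<open>y\<close>, which is 1.\<close>
  have leaf: "card (N l \<inter> D) \<le> 1" if l: "l \<in> A" "l \<noteq> x" for l
  proof -
    have "(\<Sum>v\<in>N l. f v - f l) = (\<Sum>v\<in>N l. of_bool (v = y) + of_bool (v = x) - of_bool (v \<in> D))"
    proof (intro sum.cong refl)
      fix v assume v: "v \<in> N l"
      then have "v \<in> X \<or> v = y" using NA[OF l] by blast
      moreover have "f l = -1" using l AX yX by (auto simp: f_def D_def)
      ultimately show "f v - f l = of_bool (v = y) + of_bool (v = x) - of_bool (v \<in> D)"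
        using xy yX by (auto simp: f_def)
    qed
    also have "\<dots> = int (card {v \<in> N l. v = y}) + int (card {v \<in> N l. v = x}) - int (card {v \<in> N l. v \<in> D})"
      unfolding sum_subtractf sum.distrib sum_of_bool_card[OF finite_N] ..
    also have "\<dots> \<le> 1 + 1 - int (card (N l \<inter> D))"
    proof -
      have "card {v \<in> N l. v = t} \<le> 1" for t
        using card_mono[of "{t}" "{v \<in> N l. v = t}"] by auto
      then have "int (card {v \<in> N l. v = y}) \<le> 1" "int (card {v \<in> N l. v = x}) \<le> 1"
        by (metis of_nat_le_iff of_nat_1)+
      moreover have "{v \<in> N l. v \<in> D} = N l \<inter> D" by blast
      ultimately show ?thesis by simp
    qed
    finally have "(\<Sum>v\<in>N l. f v - f l) \<le> 2 - int (card (N l \<inter> D))" by simp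
    moreover have "(\<Sum>v\<in>N y. f v - f y) * int (d l) \<le> (\<Sum>v\<in>N l. f v - f l) * int (d y)"
    proof (rule curvature[OF _ lip])
      show "y \<in> N l" using NA[OF l] by blast
      show "f y - f l = 1" using l AX yX by (auto simp: f_def D_def)
    qed
    then have "int (k + 1) \<le> (\<Sum>v\<in>N l. f v - f l) * int (k + 1)"
      using sum_y dA[OF l(1)] dy by simp
    then have "1 \<le> (\<Sum>v\<in>N l. f v - f l)"
      by (simp add: mult_le_cancel_right1)
    ultimately show ?thesis by linarith
  qed
  \<comment> \<open>The \<open>a - 1 \<ge> 2\<close> inner neighbours of a leaf lie in
    \<open>D\<close> or equal \<open>z\<close>, and at most one lies in \<open>D\<close>. So there
    are exactly two, one of them \<open>z\<close>.\<close>
  have leaf': "z \<in> N l" "card (N l \<inter> D) = 1" "a = 3" if l: "l \<in> A" "l \<noteq> x" for l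
  proof -
    have inn: "card (N l \<inter> (X - A)) + 1 = a" using innA[OF l] by (simp add: inner_degree_def)
    show zl: "z \<in> N l"
    proof (rule ccontr)
      assume "z \<notin> N l"
      then have "N l \<inter> (X - A) = N l \<inter> D" by (auto simp: D_def)
      then show False using inn leaf[OF l] a3 by simp
    qed
    then have "N l \<inter> (X - A) = insert z (N l \<inter> D)" using zX zA by (auto simp: D_def)
    then have "card (N l \<inter> (X - A)) = Suc (card (N l \<inter> D))" using xy(3) by simp
    then show "card (N l \<inter> D) = 1" "a = 3" using inn leaf[OF l] a3 by linarith+
  qed
  have "A - {x} \<noteq> {}"
  proof
    assume "A - {x} = {}"
    then have "A = {x}" using xA by blast
    then show False using card_A a3 by simp
  qed
  then obtain l where l: "l \<in> A" "l \<noteq> x" by blast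
  have a: "a = 3" using leaf'(3)[OF l] .
  have k4: "k = 4" using ka a by simp
  have NzX: "N z \<subseteq> X" using zA zX by (auto simp: boundary_def)
  have NzA: "A \<subseteq> N z" using zx leaf'(1) N_commute by blast
  have card_Nz: "d z = 3 + card (N z \<inter> D)"
  proof -
    have "N z = A \<union> (N z \<inter> D)" using NzX NzA N_irrefl by (auto simp: D_def)
    moreover have "card (A \<union> (N z \<inter> D)) = card A + card (N z \<inter> D)"
      by (intro card_Un_disjoint) (use finite_sides in \<open>auto simp: D_def\<close>)
    ultimately show ?thesis using card_A a by simp
  qed
  have sum_z: "(\<Sum>v\<in>N z. f v - f z) = 1 - int (card (N z \<inter> D))"
  proof -
    have "(\<Sum>v\<in>N z. f v - f z) = (\<Sum>v\<in>N z. of_bool (v = x) - of_bool (v \<in> D))"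
    proof (intro sum.cong refl)
      fix v assume "v \<in> N z"
      then have "v \<in> X" using NzX by blast
      then show "f v - f z = of_bool (v = x) - of_bool (v \<in> D)"
        using xy yX zX by (auto simp: f_def)
    qed
    also have "\<dots> = int (card {v \<in> N z. v = x}) - int (card {v \<in> N z. v \<in> D})"
      unfolding sum_subtractf sum_of_bool_card[OF finite_N] ..
    also have "{v \<in> N z. v = x} = {x}" using zx N_commute by blast
    also have "{v \<in> N z. v \<in> D} = N z \<inter> D" by blast
    finally show ?thesis by simp
  qed
  \<comment> \<open>With \<open>n\<close> neighbours of \<open>z\<close> in \<open>D\<close>, the
    degrees are \<open>3 + n\<close> at \<open>z\<close> and 5 at \<open>x\<close>, and the
    inequality becomes \<open>- (3 + n) \<le> 5 * (1 - n)\<close>.\<close>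
  have "(\<Sum>v\<in>N x. f v - f x) * int (d z) \<le> (\<Sum>v\<in>N z. f v - f z) * int (d x)"
  proof (rule curvature[OF _ lip])
    show "x \<in> N z" using zx N_commute by blast
    show "f x - f z = 1" using xy zX by (auto simp: f_def)
  qed
  then have NzD: "card (N z \<inter> D) \<le> 2"
    using sum_x sum_z card_Nz dA[OF xA] k4 by simp
  \<comment> \<open>Moving \<open>?T\<close> out of \<open>X\<close> removes the 4 cut edges and
    creates at most 4 new ones into \<open>D\<close>: at most two from \<open>z\<close>, none from
    \<open>x\<close>, one from each of the two leaves.\<close>
  let ?T = "insert z A"
  have XT: "X - ?T = D" by (auto simp: D_def)
  have "N l \<inter> D \<noteq> {}" using leaf'(2)[OF l] by force
  then have "?T \<subset> X" using zX AX by (auto simp: D_def)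
  then have "(\<Sum>t\<in>?T. e t) < (\<Sum>t\<in>?T. card (N t \<inter> D))"
    using move_X[of ?T] unfolding XT by blast
  also have "\<dots> = card (N z \<inter> D) + (card (N x \<inter> D) + (\<Sum>t\<in>A - {x}. card (N t \<inter> D)))"
    using zA finite_sides(3) xA by (simp add: sum.remove[of A x])
  also have "(\<Sum>t\<in>A - {x}. card (N t \<inter> D)) = (\<Sum>t\<in>A - {x}. 1)"
    by (intro sum.cong refl leaf'(2)) auto
  also have "\<dots> = 2" using xA finite_sides(3) card_A a by simp
  finally have "(\<Sum>t\<in>?T. e t) < 4" using NzD xD by simp
  moreover have "(\<Sum>t\<in>?T. e t) = e z + k"
    using zA finite_sides(1,3) cut_eq_sum_boundary by simp
  ultimately show False using k4 by simp
qed

end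

section \<open>Curvature and Lipschitz functions\<close>

text \<open>The limit is the supremum over the interval. Its existence matters because
  \<open>Lim\<close> is unspecified otherwise.\<close>

lemma mono_bounded_tendsto_at_left:
  fixes h :: "real \<Rightarrow> real"
  assumes "a < b"
    and mono: "\<And>s t. a \<le> s \<Longrightarrow> s \<le> t \<Longrightarrow> t < b \<Longrightarrow> h s \<le> h t"
    and bound: "\<And>t. a \<le> t \<Longrightarrow> t < b \<Longrightarrow> h t \<le> M"
  obtains L where "L \<le> M" "(h \<longlongrightarrow> L) (at_left b)"
proof
  define L where "L = Sup (h ` {a..<b})"
  have ne: "h ` {a..<b} \<noteq> {}" using assms(1) by simp
  have bdd: "bdd_above (h ` {a..<b})" using bound by (intro bdd_aboveI[of _ M]) auto
  show "L \<le> M" unfolding L_def using ne bound by (intro cSup_least) auto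
  show "(h \<longlongrightarrow> L) (at_left b)"
  proof (rule order_tendstoI)
    fix c assume "c < L"
    then obtain s where s: "a \<le> s" "s < b" "c < h s"
      using less_cSup_iff[OF ne bdd] by (auto simp: L_def)
    have "\<forall>t>s. t < b \<longrightarrow> c < h t"
    proof (intro allI impI)
      fix t assume "s < t" "t < b"
      then show "c < h t" using mono[of s t] s by linarith
    qed
    then show "eventually (\<lambda>t. c < h t) (at_left b)"
      using s(2) unfolding eventually_at_left[OF assms(1)] by blast
  next
    fix c assume "L < c"
    have "\<forall>t>a. t < b \<longrightarrow> h t < c"
    proof (intro allI impI)
      fix t assume "a < t" "t < b"
      then have "h t \<le> L" unfolding L_def by (intro cSup_upper bdd) auto
      then show "h t < c" using \<open>L < c\<close> by linarith
    qed
    then show "eventually (\<lambda>t. h t < c) (at_left b)"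
      using assms(1) unfolding eventually_at_left[OF assms(1)] by blast
  qed
qed

lemma adj_sym: "adj E x y \<longleftrightarrow> adj E y x"
  by (simp add: adj_def insert_commute)

lemma adj_in:
  assumes "simple_graph V E" "adj E x y"
  shows "x \<in> V" "y \<in> V" "x \<noteq> y"
  using assms by (force simp: simple_graph_def adj_def)+

lemma neighbourhoods_adj:
  assumes "simple_graph V E" "finite V"
  shows "neighbourhoods V (\<lambda>x. {y. adj E x y})"
proof
  show "finite V" by fact
  show "{y. adj E x y} \<subseteq> V" for x using adj_in(2)[OF assms(1)] by blast
  show "x \<in> {z. adj E y z}" if "y \<in> {z. adj E x z}" for x y
    using that adj_sym[of E x y] by simp
  show "x \<notin> {y. adj E x y}" for x using adj_in(3)[OF assms(1), of x x] by blast
qed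

lemma finite_nbrs:
  assumes "simple_graph V E" "finite V"
  shows "finite {y. adj E x y}"
  using neighbourhoods.finite_N[OF neighbourhoods_adj[OF assms]] .

lemma graph_dist_adj:
  assumes "simple_graph V E" "adj E x y"
  shows "graph_dist E x y = 1"
  unfolding graph_dist_def
proof (rule Least_equality)
  show "(adj E ^^ 1) x y" using assms(2) by (simp add: relcompp.simps)
  show "1 \<le> n" if "(adj E ^^ n) x y" for n
    using that adj_in(3)[OF assms] by (cases n) auto
qed

text \<open>Connectedness makes the \<open>LEAST\<close> in \<open>graph_dist\<close> attained by a
  walk, along which \<open>f\<close> rises by at most 1 per edge.\<close>

lemma lipschitz_graph_dist:
  fixes f :: "'a \<Rightarrow> real"
  assumes "connected_graph V E" "x \<in> V" "y \<in> V"
    and lip: "\<And>u v. adj E u v \<Longrightarrow> f v - f u \<le> 1"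
  shows "f y - f x \<le> real (graph_dist E x y)"
proof -
  have walk: "f z - f x \<le> real n" if "(adj E ^^ n) x z" for n z
    using that
  proof (induction n arbitrary: z)
    case (Suc n)
    then obtain w where "(adj E ^^ n) x w" "adj E w z" by auto
    then show ?case using Suc.IH[of w] lip[of w z] by simp
  qed simp
  have "(adj E)\<^sup>*\<^sup>* x y" using assms by (simp add: connected_graph_def)
  then obtain n where "(adj E ^^ n) x y" using rtranclp_imp_relpowp by metis
  then have "(adj E ^^ graph_dist E x y) x y" unfolding graph_dist_def by (rule LeastI)
  then show ?thesis by (rule walk)
qed

section \<open>Laplacian and transport of lazy measures\<close>

text \<open>The normalised Laplacian of the random walk, signed as neighbour average minus
  value.\<close>

definition laplacian :: "'a set set \<Rightarrow> ('a \<Rightarrow> real) \<Rightarrow> 'a \<Rightarrow> real" where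
  "laplacian E f x = (\<Sum>v | adj E x v. f v - f x) / real (degree E x)"

definition transport_cost :: "'a set \<Rightarrow> 'a set set \<Rightarrow> ('a \<Rightarrow> 'a \<Rightarrow> real) \<Rightarrow> real" where
  "transport_cost V E \<pi> = (\<Sum>x\<in>V. \<Sum>y\<in>V. real (graph_dist E x y) * \<pi> x y)"

text \<open>The expectation of \<open>f\<close> is affine in \<open>1 - \<rho>\<close> with the
  Laplacian as slope, which is how the Laplacian enters the transport bounds.\<close>

lemma lazy_measure_sum:
  fixes f :: "'a \<Rightarrow> real"
  assumes "simple_graph V E" "finite V" "x \<in> V" "0 < degree E x"
  shows "(\<Sum>v\<in>V. lazy_measure E \<rho> x v * f v) = f x + (1 - \<rho>) * laplacian E f x"
proof -
  let ?N = "{v. adj E x v}" and ?d = "real (degree E x)"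
  have N: "?N \<subseteq> V" "x \<notin> ?N" "finite ?N"
    using adj_in[OF assms(1)] finite_nbrs[OF assms(1,2)] by blast+
  have "(\<Sum>v\<in>V. lazy_measure E \<rho> x v * f v)
      = (\<Sum>v\<in>insert x ?N. lazy_measure E \<rho> x v * f v)"
    using assms(2,3) N(1) by (intro sum.mono_neutral_right) (auto simp: lazy_measure_def)
  also have "\<dots> = \<rho> * f x + (\<Sum>v\<in>?N. lazy_measure E \<rho> x v * f v)"
    using N by (simp add: lazy_measure_def)
  also have "(\<Sum>v\<in>?N. lazy_measure E \<rho> x v * f v) = (\<Sum>v\<in>?N. (1 - \<rho>) / ?d * f v)"
    using N(2) by (intro sum.cong refl) (auto simp: lazy_measure_def)
  also have "\<dots> = (1 - \<rho>) / ?d * (\<Sum>v\<in>?N. f v)"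
    by (simp add: sum_distrib_left)
  also have "(\<Sum>v\<in>?N. f v) = ?d * laplacian E f x + ?d * f x"
    using assms(4) by (simp add: laplacian_def sum_subtractf degree_def)
  also have "\<rho> * f x + (1 - \<rho>) / ?d * (?d * laplacian E f x + ?d * f x)
      = f x + (1 - \<rho>) * laplacian E f x"
    using assms(4) by (simp add: field_simps)
  finally show ?thesis .
qed

lemma lazy_measure_sum_1:
  assumes "simple_graph V E" "finite V" "x \<in> V" "0 < degree E x"
  shows "(\<Sum>v\<in>V. lazy_measure E \<rho> x v) = 1"
  using lazy_measure_sum[OF assms, of \<rho> "\<lambda>_. 1"] by (simp add: laplacian_def)

lemma lazy_measure_bounds:
  assumes "0 \<le> \<rho>" "\<rho> \<le> 1"
  shows "0 \<le> lazy_measure E \<rho> x v" "lazy_measure E \<rho> x v \<le> 1"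
proof -
  show "0 \<le> lazy_measure E \<rho> x v" using assms by (simp add: lazy_measure_def)
  have "(1 - \<rho>) / real (degree E x) \<le> 1"
  proof (cases "degree E x = 0")
    case False
    then have "1 \<le> real (degree E x)" by simp
    then show ?thesis using assms by (simp add: divide_le_eq)
  qed simp
  then show "lazy_measure E \<rho> x v \<le> 1" using assms by (simp add: lazy_measure_def)
qed

text \<open>The product measure is a coupling. Without one, the infimum defining
  \<open>wasserstein\<close> would carry no information.\<close>

lemma couplings_lazy_nonempty:
  assumes "simple_graph V E" "finite V" "x \<in> V" "0 < degree E x" "y \<in> V" "0 < degree E y"
    and "0 \<le> \<rho>" "\<rho> \<le> 1"
  shows "couplings V (lazy_measure E \<rho> x) (lazy_measure E \<rho> y) \<noteq> {}"
proof -
  have "(\<lambda>u v. lazy_measure E \<rho> x u * lazy_measure E \<rho> y v)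
      \<in> couplings V (lazy_measure E \<rho> x) (lazy_measure E \<rho> y)"
    using lazy_measure_sum_1[OF assms(1,2,3,4)] lazy_measure_sum_1[OF assms(1,2,5,6)]
    by (auto simp: couplings_def simp flip: sum_distrib_left sum_distrib_right
        intro!: mult_nonneg_nonneg mult_le_one lazy_measure_bounds[OF assms(7,8)])
  then show ?thesis by blast
qed

lemma transport_cost_nonneg:
  "\<pi> \<in> couplings V \<mu>1 \<mu>2 \<Longrightarrow> 0 \<le> transport_cost V E \<pi>"
  unfolding transport_cost_def by (intro sum_nonneg) (auto simp: couplings_def)

lemma wasserstein_le:
  assumes "\<pi> \<in> couplings V \<mu>1 \<mu>2"
  shows "wasserstein V E \<mu>1 \<mu>2 \<le> transport_cost V E \<pi>"
  unfolding wasserstein_def transport_cost_def[symmetric]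
  using assms transport_cost_nonneg by (intro cINF_lower bdd_belowI2) auto

lemma wasserstein_ge:
  assumes "couplings V \<mu>1 \<mu>2 \<noteq> {}"
    and "\<And>\<pi>. \<pi> \<in> couplings V \<mu>1 \<mu>2 \<Longrightarrow> c \<le> transport_cost V E \<pi>"
  shows "c \<le> wasserstein V E \<mu>1 \<mu>2"
  unfolding wasserstein_def transport_cost_def[symmetric]
  using assms by (intro cINF_greatest)

text \<open>Easy half of Kantorovich duality: the marginal conditions turn both expectations into
  sums over the coupling, and \<open>f v - f u\<close> is at most the distance term by term.\<close>

lemma transport_cost_ge_dual:
  fixes f :: "'a \<Rightarrow> real"
  assumes "connected_graph V E" "\<pi> \<in> couplings V \<mu>1 \<mu>2"
    and lip: "\<And>u v. adj E u v \<Longrightarrow> f v - f u \<le> 1"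
  shows "(\<Sum>v\<in>V. \<mu>2 v * f v) - (\<Sum>u\<in>V. \<mu>1 u * f u) \<le> transport_cost V E \<pi>"
proof -
  have "(\<Sum>v\<in>V. \<mu>2 v * f v) = (\<Sum>v\<in>V. \<Sum>u\<in>V. f v * \<pi> u v)"
    using assms(2)
    by (intro sum.cong refl) (simp add: couplings_def mult.commute flip: sum_distrib_left)
  also have "\<dots> = (\<Sum>u\<in>V. \<Sum>v\<in>V. f v * \<pi> u v)" by (rule sum.swap)
  finally have 1: "(\<Sum>v\<in>V. \<mu>2 v * f v) = (\<Sum>u\<in>V. \<Sum>v\<in>V. f v * \<pi> u v)" .
  have 2: "(\<Sum>u\<in>V. \<mu>1 u * f u) = (\<Sum>u\<in>V. \<Sum>v\<in>V. f u * \<pi> u v)"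
    using assms(2)
    by (intro sum.cong refl) (simp add: couplings_def mult.commute flip: sum_distrib_left)
  have "(\<Sum>u\<in>V. \<Sum>v\<in>V. (f v - f u) * \<pi> u v) \<le> transport_cost V E \<pi>"
    unfolding transport_cost_def
  proof (intro sum_mono mult_right_mono)
    fix u v assume "u \<in> V" "v \<in> V"
    then show "f v - f u \<le> real (graph_dist E u v)" "0 \<le> \<pi> u v"
      using lipschitz_graph_dist[OF assms(1) _ _ lip] assms(2) by (auto simp: couplings_def)
  qed
  then show ?thesis unfolding 1 2 by (simp add: left_diff_distrib sum_subtractf)
qed

lemma transport_cost_dirac:
  assumes "finite V" "x \<in> V" "y \<in> V"
  shows "transport_cost V E (\<lambda>u v. of_bool (u = x) * of_bool (v = y)) = real (graph_dist E x y)"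
proof -
  have "transport_cost V E (\<lambda>u v. of_bool (u = x) * of_bool (v = y))
      = (\<Sum>u\<in>V. \<Sum>v\<in>V. of_bool (u = x) * (of_bool (v = y) * real (graph_dist E u v)))"
    unfolding transport_cost_def by (intro sum.cong refl) simp
  also have "\<dots> = real (graph_dist E x y)"
    using assms by (simp flip: sum_distrib_left)
  finally show ?thesis .
qed

text \<open>The witness mixes a coupling with the transport of a unit mass from \<open>x\<close> to \<open>y\<close>.\<close>

lemma wasserstein_lazy_mix:
  assumes "simple_graph V E" "finite V" "x \<in> V" "0 < degree E x" "y \<in> V" "0 < degree E y"
    and "0 \<le> \<rho>" "\<rho> < 1" "0 \<le> t" "t \<le> 1" "1 - \<rho>' = t * (1 - \<rho>)"
  shows "wasserstein V E (lazy_measure E \<rho>' x) (lazy_measure E \<rho>' y)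
    \<le> t * wasserstein V E (lazy_measure E \<rho> x) (lazy_measure E \<rho> y)
      + (1 - t) * real (graph_dist E x y)"
proof (cases "t = 0")
  case False
  let ?W' = "wasserstein V E (lazy_measure E \<rho>' x) (lazy_measure E \<rho>' y)"
  have t: "0 < t" using False assms(9) by simp
  have mix: "lazy_measure E \<rho>' z u = t * lazy_measure E \<rho> z u + (1 - t) * of_bool (u = z)" for z u
    using assms(11) by (auto simp: lazy_measure_def algebra_simps)
  \<comment> \<open>The claim is solved for the cost of an arbitrary coupling, so that
    \<open>wasserstein_ge\<close> can pass to the infimum.\<close>
  have "(?W' - (1 - t) * real (graph_dist E x y)) / t \<le> transport_cost V E \<pi>"
    if \<pi>: "\<pi> \<in> couplings V (lazy_measure E \<rho> x) (lazy_measure E \<rho> y)" for \<pi>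
  proof -
    define \<pi>' where "\<pi>' u v = t * \<pi> u v + (1 - t) * (of_bool (u = x) * of_bool (v = y))" for u v
    have "\<pi>' \<in> couplings V (lazy_measure E \<rho>' x) (lazy_measure E \<rho>' y)"
      unfolding couplings_def
    proof (intro CollectI conjI ballI)
      fix u v assume "u \<in> V" "v \<in> V"
      then have b: "0 \<le> \<pi> u v" "\<pi> u v \<le> 1" using \<pi> by (auto simp: couplings_def)
      then show "0 \<le> \<pi>' u v" using assms(9,10) by (simp add: \<pi>'_def)
      have "t * \<pi> u v \<le> t * 1" using b assms(9) by (intro mult_left_mono) auto
      moreover have "(1 - t) * (of_bool (u = x) * of_bool (v = y)) \<le> (1 - t) * 1"
        using assms(10) by (intro mult_left_mono) auto
      ultimately show "\<pi>' u v \<le> 1" by (simp add: \<pi>'_def)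
    next
      fix u assume "u \<in> V"
      then show "(\<Sum>v\<in>V. \<pi>' u v) = lazy_measure E \<rho>' x u"
        using \<pi> assms(2,5) unfolding mix
        by (simp add: \<pi>'_def sum.distrib couplings_def flip: sum_distrib_left)
    next
      fix v assume "v \<in> V"
      then show "(\<Sum>u\<in>V. \<pi>' u v) = lazy_measure E \<rho>' y v"
        using \<pi> assms(2,3) unfolding mix
        by (simp add: \<pi>'_def sum.distrib couplings_def flip: sum_distrib_left sum_distrib_right)
    qed
    then have "?W' \<le> transport_cost V E \<pi>'" by (rule wasserstein_le)
    also have "\<dots> = t * transport_cost V E \<pi>
        + (1 - t) * transport_cost V E (\<lambda>u v. of_bool (u = x) * of_bool (v = y))"
      by (simp add: transport_cost_def \<pi>'_def sum_distrib_left sum.distrib sum_subtractf algebra_simps)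
    also note transport_cost_dirac[OF assms(2,3,5)]
    finally show ?thesis using t by (simp add: field_simps)
  qed
  then have "(?W' - (1 - t) * real (graph_dist E x y)) / t
      \<le> wasserstein V E (lazy_measure E \<rho> x) (lazy_measure E \<rho> y)"
    using couplings_lazy_nonempty[OF assms(1-7)] assms(8) by (intro wasserstein_ge) auto
  then show ?thesis using t by (simp add: field_simps)
next
  case True
  \<comment> \<open>Here \<open>\<rho>' = 1\<close>, and both measures are point masses.\<close>
  have "(\<lambda>u v. of_bool (u = x) * of_bool (v = y)) \<in> couplings V (lazy_measure E \<rho>' x) (lazy_measure E \<rho>' y)"
    using True assms by (auto simp: couplings_def lazy_measure_def)
  from wasserstein_le[OF this, of E] show ?thesis
    using True transport_cost_dirac[OF assms(2,3,5), of E] by simp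
qed

lemma LLY_curvature_le:
  fixes f :: "'a \<Rightarrow> real"
  assumes graph: "simple_graph V E" "finite V" "connected_graph V E" and xy: "adj E x y"
    and lip: "\<And>u v. adj E u v \<Longrightarrow> f v - f u \<le> 1" and f: "f y - f x = 1"
  shows "LLY_curvature V E x y \<le> laplacian E f x - laplacian E f y"
proof -
  note V = adj_in(1,2)[OF graph(1) xy]
  have d: "0 < degree E x" "0 < degree E y"
    using xy adj_sym[of E x y] finite_nbrs[OF graph(1,2)]
    by (auto simp: degree_def card_gt_0_iff)
  define W where "W \<rho> = wasserstein V E (lazy_measure E \<rho> x) (lazy_measure E \<rho> y)" for \<rho>
  define h where "h \<rho> = lazy_curvature V E \<rho> x y / (1 - \<rho>)" for \<rho>
  have h: "h \<rho> = (1 - W \<rho>) / (1 - \<rho>)" for \<rho>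
    by (simp add: h_def lazy_curvature_def W_def graph_dist_adj[OF graph(1) xy])
  have mono: "h s \<le> h t" if "0 \<le> s" "s \<le> t" "t < 1" for s t
  proof -
    \<comment> \<open>The weight for which laziness \<open>t\<close> is the mixture of laziness
      \<open>s\<close> and laziness 1.\<close>
    define c where "c = (1 - t) / (1 - s)"
    have "0 \<le> c" "c \<le> 1" "1 - t = c * (1 - s)" using that by (auto simp: c_def field_simps)
    then have "W t \<le> c * W s + (1 - c) * real (graph_dist E x y)"
      unfolding W_def using that by (intro wasserstein_lazy_mix[OF graph(1,2) V(1) d(1) V(2) d(2)]) auto
    then have "c * (1 - W s) \<le> 1 - W t"
      by (simp add: graph_dist_adj[OF graph(1) xy] algebra_simps)
    then show ?thesis using that by (simp add: h c_def field_simps)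
  qed
  have bound: "h t \<le> laplacian E f x - laplacian E f y" if "0 \<le> t" "t < 1" for t
  proof -
    have "1 + (1 - t) * (laplacian E f y - laplacian E f x) \<le> W t"
      unfolding W_def
    proof (rule wasserstein_ge)
      show "couplings V (lazy_measure E t x) (lazy_measure E t y) \<noteq> {}"
        using that by (intro couplings_lazy_nonempty graph V d) auto
      fix \<pi> assume "\<pi> \<in> couplings V (lazy_measure E t x) (lazy_measure E t y)"
      then have "(\<Sum>v\<in>V. lazy_measure E t y v * f v) - (\<Sum>u\<in>V. lazy_measure E t x u * f u)
          \<le> transport_cost V E \<pi>"
        using lip by (rule transport_cost_ge_dual[OF graph(3)])
      then show "1 + (1 - t) * (laplacian E f y - laplacian E f x) \<le> transport_cost V E \<pi>"
        unfolding lazy_measure_sum[OF graph(1,2) V(1) d(1)] lazy_measure_sum[OF graph(1,2) V(2) d(2)]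
        using f by (simp add: algebra_simps)
    qed
    then have "1 - W t \<le> (1 - t) * (laplacian E f x - laplacian E f y)"
      by (simp add: algebra_simps)
    then show ?thesis using that by (simp add: h divide_le_eq mult.commute)
  qed
  obtain L where L: "L \<le> laplacian E f x - laplacian E f y" "(h \<longlongrightarrow> L) (at_left 1)"
    using mono_bounded_tendsto_at_left[OF zero_less_one mono bound] .
  have "LLY_curvature V E x y = L"
    unfolding LLY_curvature_def h_def[symmetric]
    using L(2) by (intro tendsto_Lim trivial_limit_at_left_real)
  then show ?thesis using L(1) by simp
qed

text \<open>Clearing both degrees and returning to the integers yields the assumption
  \<open>curvature\<close> of \<open>small_cut_atom\<close>.\<close>

lemma nonneg_LLY_imp_laplacian_le:
  fixes f :: "'a \<Rightarrow> int"
  assumes graph: "simple_graph V E" "finite V" "connected_graph V E" "nonneg_LLY_curvature V E"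
    and xy: "adj E x y"
    and lip: "\<And>u v. adj E u v \<Longrightarrow> f v - f u \<le> 1" and f: "f y - f x = 1"
  shows "(\<Sum>v | adj E y v. f v - f y) * int (card {v. adj E x v})
    \<le> (\<Sum>v | adj E x v. f v - f x) * int (card {v. adj E y v})"
proof -
  let ?f = "\<lambda>v. real_of_int (f v)"
  have d: "0 < degree E x" "0 < degree E y"
    using xy adj_sym[of E x y] finite_nbrs[OF graph(1,2)]
    by (auto simp: degree_def card_gt_0_iff)
  have "0 \<le> LLY_curvature V E x y"
    using graph(4) adj_in[OF graph(1) xy] by (simp add: nonneg_LLY_curvature_def)
  also have "\<dots> \<le> laplacian E ?f x - laplacian E ?f y"
  proof (rule LLY_curvature_le[OF graph(1-3) xy])
    show "?f v - ?f u \<le> 1" if "adj E u v" for u v using lip[OF that] by linarith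
    show "?f y - ?f x = 1" using f by linarith
  qed
  finally have "(\<Sum>v | adj E y v. ?f v - ?f y) * real (degree E x)
      \<le> (\<Sum>v | adj E x v. ?f v - ?f x) * real (degree E y)"
    using d by (simp add: laplacian_def field_simps)
  then have "real_of_int ((\<Sum>v | adj E y v. f v - f y) * int (degree E x))
      \<le> real_of_int ((\<Sum>v | adj E x v. f v - f x) * int (degree E y))"
    by simp
  then show ?thesis unfolding of_int_le_iff degree_def .
qed

section \<open>Edge connectivity\<close>

lemma connected_exit:
  assumes "connected_graph V E" "S \<subset> V" "S \<noteq> {}"
  obtains u v where "u \<in> S" "v \<notin> S" "adj E u v"
proof -
  obtain x y where xy: "x \<in> S" "y \<in> V" "y \<notin> S" using assms by blast
  then have "(adj E)\<^sup>*\<^sup>* x y" using assms by (auto simp: connected_graph_def)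
  then have "y \<in> S \<or> (\<exists>u\<in>S. \<exists>v. v \<notin> S \<and> adj E u v)"
    using xy(1) by (induction) blast+
  then show thesis using xy that by blast
qed

lemma min_degree_le_cut:
  assumes graph: "simple_graph V E" "finite V" "connected_graph V E" "nonneg_LLY_curvature V E"
    and S: "S \<subset> V" "S \<noteq> {}"
  shows "min_degree V E \<le> neighbourhoods.cut (\<lambda>x. {y. adj E x y}) S"
proof (rule ccontr)
  let ?N = "\<lambda>x. {y. adj E x y}"
  interpret neighbourhoods V ?N using neighbourhoods_adj[OF graph(1,2)] .
  let ?P = "\<lambda>S. S \<subset> V \<and> S \<noteq> {}"
  assume less: "\<not> min_degree V E \<le> cut S"
  have "\<exists>X0. ?P X0 \<and> (\<forall>T. ?P T \<longrightarrow> cut X0 \<le> cut T)"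
    using S by (intro ex_has_least_nat[where k = S]) simp
  then obtain X0 where X0: "?P X0" "\<And>T. ?P T \<Longrightarrow> cut X0 \<le> cut T" by metis
  \<comment> \<open>A minimiser with fewest vertices: its nonempty proper subsets have strictly
    larger cuts, as \<open>atom\<close> demands.\<close>
  have "\<exists>X. (?P X \<and> cut X = cut X0) \<and> (\<forall>T. ?P T \<and> cut T = cut X0 \<longrightarrow> card X \<le> card T)"
    using X0(1) by (intro ex_has_least_nat[where k = X0]) simp
  then obtain X where X: "?P X" "cut X = cut X0"
    and small: "\<And>T. ?P T \<Longrightarrow> cut T = cut X0 \<Longrightarrow> card X \<le> card T" by metis
  have "small_cut_atom V ?N X"
  proof (intro small_cut_atom.intro small_cut_atom_axioms.intro neighbourhoods_axioms)
    show "X \<subset> V" "X \<noteq> {}" using X by auto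
    show "0 < cut X"
    proof -
      obtain u v where "u \<in> X" "v \<notin> X" "adj E u v" using connected_exit[OF graph(3)] X by blast
      then have "u \<in> boundary X" by (auto simp: boundary_def)
      then have "0 < card (boundary X)"
        using X finite_V boundary_subset finite_subset by (metis card_gt_0_iff empty_iff psubset_imp_subset)
      then show ?thesis
        using card_boundary_le_cut[of X] X finite_V finite_subset by (metis le_zero_eq not_gr0 psubset_imp_subset)
    qed
    show "cut X < card (?N v)" if "v \<in> V" for v
    proof -
      have "min_degree V E \<le> card (?N v)"
        using that graph(2) unfolding min_degree_def degree_def by (intro Min_le) auto
      then show ?thesis using less X0(2)[of S] X(2) S by linarith
    qed
    show "cut X \<le> cut T" if "T \<subset> V" "T \<noteq> {}" for T using X0(2) X(2) that by simp
    show "cut X < cut T" if "T \<subset> X" "T \<noteq> {}" for T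
    proof (rule ccontr)
      have T: "?P T" using that X by blast
      assume "\<not> cut X < cut T"
      then have "cut T = cut X0" using X0(2)[OF T] X(2) by linarith
      then have "card X \<le> card T" using small T by blast
      moreover have "finite X" using X finite_V finite_subset by blast
      ultimately show False using psubset_card_mono[OF _ that(1)] by simp
    qed
    show "(\<Sum>v\<in>?N y. f v - f y) * int (card (?N x)) \<le> (\<Sum>v\<in>?N x. f v - f x) * int (card (?N y))"
      if "y \<in> ?N x" "\<And>u v. v \<in> ?N u \<Longrightarrow> f v - f u \<le> 1" "f y - f x = 1"
      for f :: "'a \<Rightarrow> int" and x y
      using nonneg_LLY_imp_laplacian_le[OF graph, of x y f] that by simp
  qed
  then show False by (rule small_cut_atom.no_small_cut_atom)
qed

lemma graph_components_connected:
  assumes "connected_graph V E"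
  shows "graph_components V E = {V}"
  using assms by (auto simp: graph_components_def quotient_def connected_graph_def)

text \<open>Deleting \<open>F\<close> leaves a component \<open>S\<close> other than
  \<open>V\<close>, and every edge leaving \<open>S\<close> has to belong to
  \<open>F\<close>.\<close>

lemma edge_cut_contains_cut:
  assumes graph: "simple_graph V E" "finite V" "connected_graph V E" and F: "edge_cut V E F"
  obtains S where "S \<subset> V" "S \<noteq> {}" "neighbourhoods.cut (\<lambda>x. {y. adj E x y}) S \<le> card F"
proof -
  interpret neighbourhoods V "\<lambda>x. {y. adj E x y}" using neighbourhoods_adj[OF graph(1,2)] .
  have FE: "F \<subseteq> E" and card: "1 < card (graph_components V (E - F))"
    using F graph_components_connected[OF graph(3)] by (auto simp: edge_cut_def)
  have "E \<subseteq> Pow V" using graph(1) by (auto simp: simple_graph_def)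
  then have finF: "finite F" using FE graph(2) by (meson finite_Pow_iff finite_subset)
  have "\<not> graph_components V (E - F) \<subseteq> {V}"
    using card card_mono[of "{V}" "graph_components V (E - F)"] by auto
  then obtain S where S: "S \<in> graph_components V (E - F)" "S \<noteq> V" by blast
  then obtain x where x: "x \<in> V" "S = {y \<in> V. (adj (E - F))\<^sup>*\<^sup>* x y}"
    by (auto simp: graph_components_def quotient_def)
  have "cut S \<le> card F"
  proof -
    have edges: "{u, v} \<in> F" if "u \<in> S" "adj E u v" "v \<notin> S" for u v
    proof (rule ccontr)
      assume "{u, v} \<notin> F"
      then have "adj (E - F) u v" using that(2) by (simp add: adj_def)
      then have "v \<in> S" using that(1) x(2) adj_in(2)[OF graph(1) that(2)]
        by (auto intro: rtranclp.rtrancl_into_rtrancl)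
      then show False using that(3) by simp
    qed
    \<comment> \<open>Edges leaving \<open>S\<close> are counted as outward pairs; forgetting the
      orientation is injective because only the first end lies in \<open>S\<close>.\<close>
    have "cut S = card (SIGMA u:S. {v. adj E u v} - S)"
      unfolding cut_def using x(2) graph(2) finite_N by (subst card_SigmaI) auto
    also have "\<dots> \<le> card F"
    proof (rule card_inj_on_le[OF _ _ finF])
      show "inj_on (\<lambda>(u, v). {u, v}) (SIGMA u:S. {v. adj E u v} - S)"
        by (auto simp: inj_on_def doubleton_eq_iff)
      show "(\<lambda>(u, v). {u, v}) ` (SIGMA u:S. {v. adj E u v} - S) \<subseteq> F"
        using edges by auto
    qed
    finally show ?thesis .
  qed
  moreover have "S \<subset> V" "S \<noteq> {}" using S(2) x by auto
  ultimately show thesis using that by blast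
qed

text \<open>Without its edges \<open>v\<close> forms a component by itself, and any other vertex
  lies in a different one.\<close>

lemma edge_cut_at_vertex:
  assumes graph: "simple_graph V E" "finite V" "connected_graph V E" and v: "v \<in> V" "V \<noteq> {v}"
  shows "edge_cut V E {e \<in> E. v \<in> e}"
proof -
  let ?F = "{e \<in> E. v \<in> e}"
  let ?R = "{(x, y). x \<in> V \<and> y \<in> V \<and> (adj (E - ?F))\<^sup>*\<^sup>* x y}"
  have "y = v" if "(adj (E - ?F))\<^sup>*\<^sup>* v y" for y
    using that by (cases rule: converse_rtranclpE) (auto simp: adj_def)
  then have Rv: "?R `` {v} = {v}" using v by auto
  obtain u where u: "u \<in> V" "u \<noteq> v" using v by blast
  have "u \<in> ?R `` {u}" using u by simp
  then have ne: "?R `` {u} \<noteq> {v}" using u by blast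
  have "{{v}, ?R `` {u}} \<subseteq> graph_components V (E - ?F)"
    using quotientI[OF v(1), of ?R] quotientI[OF u(1), of ?R]
    unfolding graph_components_def Rv by blast
  moreover have "graph_components V (E - ?F) \<subseteq> Pow V"
    by (auto simp: graph_components_def quotient_def)
  then have "finite (graph_components V (E - ?F))"
    using graph(2) by (meson finite_Pow_iff finite_subset)
  ultimately have "card {{v}, ?R `` {u}} \<le> card (graph_components V (E - ?F))"
    by (intro card_mono)
  then show ?thesis
    using ne graph_components_connected[OF graph(3)] by (auto simp: edge_cut_def)
qed

lemma card_edges_at_vertex:
  assumes "simple_graph V E"
  shows "card {e \<in> E. v \<in> e} = degree E v"
proof -
  have "bij_betw (\<lambda>y. {v, y}) {y. adj E v y} {e \<in> E. v \<in> e}"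
  proof (rule bij_betw_imageI)
    show "inj_on (\<lambda>y. {v, y}) {y. adj E v y}" by (auto simp: inj_on_def doubleton_eq_iff)
    have "\<exists>y. e = {v, y}" if "e \<in> E" "v \<in> e" for e
    proof -
      have "card e = 2" using that assms by (auto simp: simple_graph_def)
      then show ?thesis using that(2) by (auto simp: card_2_iff)
    qed
    then show "(\<lambda>y. {v, y}) ` {y. adj E v y} = {e \<in> E. v \<in> e}"
      by (auto simp: adj_def image_def)
  qed
  then show ?thesis by (simp add: bij_betw_same_card degree_def)
qed

text \<open>The edges at a vertex of least degree form an edge cut. Conversely, any edge cut has at
  least as many edges as leave some nonempty proper vertex subset, to which
  \<open>min_degree_le_cut\<close> applies.\<close>

theorem theorem1p2:
  fixes V :: "'a set" and E :: "'a set set"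
  assumes "simple_graph V E"
    and "finite V"
    and "connected_graph V E"
    and "nonneg_LLY_curvature V E"
  shows "edge_connectivity V E = min_degree V E"
proof (cases "card V = 1")
  case True
  then obtain v where V: "V = {v}" by (auto simp: card_1_singleton_iff)
  have "{y. adj E v y} = {}" using adj_in[OF assms(1), of v] V by blast
  then show ?thesis using V by (simp add: edge_connectivity_def min_degree_def degree_def)
next
  case False
  have "V \<noteq> {}" using assms(3) by (simp add: connected_graph_def)
  then have "min_degree V E \<in> degree E ` V"
    unfolding min_degree_def using assms(2) by (intro Min_in) auto
  then obtain v where v: "v \<in> V" "min_degree V E = degree E v" by blast
  have "V \<noteq> {v}" using False by auto
  then have cut: "edge_cut V E {e \<in> E. v \<in> e}"
    using edge_cut_at_vertex[OF assms(1-3) v(1)] by blast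
  have "E \<subseteq> Pow V" using assms(1) by (auto simp: simple_graph_def)
  then have "finite E" using assms(2) by (meson finite_Pow_iff finite_subset)
  \<comment> \<open>Finiteness is what gives \<open>Min\<close> its meaning.\<close>
  then have "finite {F. edge_cut V E F}"
    by (rule_tac finite_subset[of _ "Pow E"]) (auto simp: edge_cut_def)
  then have "finite {card F | F. edge_cut V E F}" by simp
  moreover have "min_degree V E \<le> n" if n: "n \<in> {card F | F. edge_cut V E F}" for n
  proof -
    obtain F where F: "edge_cut V E F" "n = card F" using n by blast
    obtain S where "S \<subset> V" "S \<noteq> {}" "neighbourhoods.cut (\<lambda>x. {y. adj E x y}) S \<le> card F"
      using edge_cut_contains_cut[OF assms(1-3) F(1)] .
    then show ?thesis using min_degree_le_cut[OF assms, of S] F(2) by linarith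
  qed
  moreover have "min_degree V E \<in> {card F | F. edge_cut V E F}"
    using cut v(2) card_edges_at_vertex[OF assms(1), of v] by (intro CollectI exI) auto
  ultimately have "Min {card F | F. edge_cut V E F} = min_degree V E"
    by (rule Min_eqI)
  then show ?thesis using False by (simp add: edge_connectivity_def)
qed

end
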